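(* For every $n\ge0$ and every $b\in\mathcal A_{n+1}$, $$\mathcal E_{n+1}[b]=\sum_{i,j=1}^3\mathcal E_n\big[(e_{ij}^*\otimes id_n)\,b\big].$$
   Context: Indices $j\in\{1,2,3\}$ are taken mod $3$. $M_3(\mathbb C)$ has matrix units $e_{ij}$, and $\mathbb C^3$ is identified with its diagonal subalgebra. For $n\ge0$ put $\alpha^n_j=e_{jj}\otimes e_{22}^{\otimes n}\in M_3(\mathbb C)^{\otimes(n+1)}$, and for $k\ge1$ put $\beta^k_j=(e_{jj}\otimes e_{11}+e_{j+2,j+2}\otimes e_{33})\otimes e_{22}^{\otimes(k-1)}\in M_3(\mathbb C)^{\otimes(k+1)}$. The finite-dimensional $*$-algebra $\mathcal A_n\subset M_3(\mathbb C)^{\otimes n}\otimes\mathbb C^3\subset M_3(\mathbb C)^{\otimes(n+1)}$ is the linear span of the $\alpha^n_j$ and of the $x\otimes\beta^k_j$ with $j=1,2,3$, $k=1,\dots,n$, $x\in M_3(\mathbb C)^{\otimes(n-k)}$. Let $V_0=\{v_1,v_2,v_3\}$ be a three-point set and identify $\mathbb C^3=\mathbb C(V_0)$ with $e_{ii}$ the indicator function of $v_i$; so $b\in M_3(\mathbb C)^{\otimes n}\otimes\mathbb C^3$ is written $b=\sum_i b(v_i)\otimes e_{ii}$ with $b(v_i)\in M_3(\mathbb C)^{\otimes n}$. For $b\in\mathcal A_n$, $\mathcal E_n[b]=\sum_{i\ne j}\mathrm{Tr}\big(|b(v_i)-b(v_j)|^2\big)$, where $\mathrm{Tr}$ is the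 unnormalized trace on $M_3(\mathbb C)^{\otimes n}$ and $i,j$ range over $\{1,2,3\}$. The map $e_{ij}^*\otimes id_n$ applies the functional $e_{ij}^*:m\mapsto m_{ij}$ to the first (leftmost) tensor factor and the identity to the remaining ones; it maps $\mathcal A_{n+1}\subset M_3(\mathbb C)\otimes\mathcal A_n$ into $\mathcal A_n$. *)

theory Defs
  imports "Jordan_Normal_Form.Schur_Decomposition"
begin

text \<open>
  The algebra $M_3(\mathbb C)^{\otimes m}$ is realised as the complex matrices of size $3^m$, the
  tensor product of elements being the Kronecker product; for $m = 0$ these are the scalars.
  The leftmost tensor factor is the most significant base-3 digit of a row or column index.
\<close>

abbreviation M3_tensor :: "nat \<Rightarrow> complex mat set" where
  "M3_tensor m \<equiv> carrier_mat (3 ^ m) (3 ^ m)"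

definition kron :: "complex mat \<Rightarrow> complex mat \<Rightarrow> complex mat"  (infixl "\<otimes>\<^sub>K" 70) where
  "A \<otimes>\<^sub>K B = mat (dim_row A * dim_row B) (dim_col A * dim_col B)
     (\<lambda>(p, q). A $$ (p div dim_row B, q div dim_col B) * B $$ (p mod dim_row B, q mod dim_col B))"

fun tensor_power :: "complex mat \<Rightarrow> nat \<Rightarrow> complex mat" where
  "tensor_power A 0 = 1\<^sub>m 1"
| "tensor_power A (Suc n) = A \<otimes>\<^sub>K tensor_power A n"

text \<open>
  The indices $1, 2, 3$ are taken mod 3 and correspond to the matrix positions $0, 1, 2$.
\<close>

definition pos :: "nat \<Rightarrow> nat" where
  "pos j = (j + 2) mod 3"

definition munit :: "nat \<Rightarrow> nat \<Rightarrow> complex mat" where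
  "munit i j = mat 3 3 (\<lambda>(p, q). if p = pos i \<and> q = pos j then 1 else 0)"

definition alpha :: "nat \<Rightarrow> nat \<Rightarrow> complex mat" where
  "alpha n j = munit j j \<otimes>\<^sub>K tensor_power (munit 2 2) n"

definition beta :: "nat \<Rightarrow> nat \<Rightarrow> complex mat" where
  "beta k j = (munit j j \<otimes>\<^sub>K munit 1 1 + munit (j + 2) (j + 2) \<otimes>\<^sub>K munit 3 3) \<otimes>\<^sub>K tensor_power (munit 2 2) (k - 1)"

definition A_gens :: "nat \<Rightarrow> complex mat set" where
  "A_gens n = {alpha n j | j. j \<in> {1..3}} \<union>
     {x \<otimes>\<^sub>K beta k j | x j k. j \<in> {1..3} \<and> k \<in> {1..n} \<and> x \<in> M3_tensor (n - k)}"

definition A_alg :: "nat \<Rightarrow> complex mat set" where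
  "A_alg n = LinearCombinations.module.span class_ring
     (module_mat TYPE(complex) (3 ^ (n + 1)) (3 ^ (n + 1))) (A_gens n)"

text \<open>
  \<open>vertex_value n b i\<close> is $b(v_i) \in M_3(\mathbb C)^{\otimes n}$ for
  $b = \sum_i b(v_i) \otimes e_{ii} \in M_3(\mathbb C)^{\otimes n} \otimes \mathbb C^3$;
  see \<open>vertex_value_unique\<close> and \<open>A_alg_decomp\<close> below.
\<close>

definition vertex_value :: "nat \<Rightarrow> complex mat \<Rightarrow> nat \<Rightarrow> complex mat" where
  "vertex_value n b i = mat (3 ^ n) (3 ^ n) (\<lambda>(p, q). b $$ (3 * p + pos i, 3 * q + pos i))"

definition Tr :: "complex mat \<Rightarrow> complex" where
  "Tr A = (\<Sum>p<dim_row A. A $$ (p, p))"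

definition abs_sq :: "complex mat \<Rightarrow> complex mat" where
  "abs_sq A = mat_adjoint A * A"

definition energy :: "nat \<Rightarrow> complex mat \<Rightarrow> complex" where
  "energy n b = (\<Sum>(i, j) \<in> {(i, j). i \<in> {1..3} \<and> j \<in> {1..3} \<and> i \<noteq> j}.
     Tr (abs_sq (vertex_value n b i - vertex_value n b j)))"

text \<open>
  \<open>first_slice m i j\<close> is $e_{ij}^* \otimes \mathrm{id}$ on
  $M_3(\mathbb C) \otimes M_3(\mathbb C)^{\otimes m}$; see \<open>first_slice_kron\<close> below.
\<close>

definition first_slice :: "nat \<Rightarrow> nat \<Rightarrow> nat \<Rightarrow> complex mat \<Rightarrow> complex mat" where
  "first_slice m i j b = mat (3 ^ m) (3 ^ m) (\<lambda>(p, q). b $$ (pos i * 3 ^ m + p, pos j * 3 ^ m + q))"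

lemma kron_dim [simp]:
  "dim_row (A \<otimes>\<^sub>K B) = dim_row A * dim_row B" "dim_col (A \<otimes>\<^sub>K B) = dim_col A * dim_col B"
  by (simp_all add: kron_def)

lemma kron_carrier:
  "A \<in> carrier_mat r c \<Longrightarrow> B \<in> carrier_mat r' c' \<Longrightarrow> A \<otimes>\<^sub>K B \<in> carrier_mat (r * r') (c * c')"
  by (rule carrier_matI) auto

lemma kron_index:
  assumes "p < dim_row A * dim_row B" "q < dim_col A * dim_col B"
  shows "(A \<otimes>\<^sub>K B) $$ (p, q) =
    A $$ (p div dim_row B, q div dim_col B) * B $$ (p mod dim_row B, q mod dim_col B)"
  using assms by (simp add: kron_def)

lemma pos_less: "pos j < 3"
  by (simp add: pos_def)

lemma munit_carrier [simp]: "munit i j \<in> carrier_mat 3 3" "dim_row (munit i j) = 3" "dim_col (munit i j) = 3"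
  by (simp_all add: munit_def)

lemma tensor_power_carrier: "A \<in> carrier_mat 3 3 \<Longrightarrow> tensor_power A n \<in> M3_tensor n"
  by (induction n) (auto intro: kron_carrier)

lemma first_slice_carrier [simp]:
  "first_slice m i j b \<in> M3_tensor m"
  "dim_row (first_slice m i j b) = 3 ^ m" "dim_col (first_slice m i j b) = 3 ^ m"
  by (simp_all add: first_slice_def)

lemma block_less:
  fixes r p m N :: nat
  assumes "r < m" "p < N"
  shows "r * N + p < m * N"
proof -
  have "r * N + p < Suc r * N" using assms by simp
  also have "\<dots> \<le> m * N" using assms by (intro mult_right_mono) auto
  finally show ?thesis .
qed

lemma first_slice_kron:
  assumes x: "x \<in> carrier_mat 3 3" and y: "y \<in> M3_tensor m"
  shows "first_slice m i j (x \<otimes>\<^sub>K y) = x $$ (pos i, pos j) \<cdot>\<^sub>m y"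
proof (rule eq_matI)
  fix p q assume "p < dim_row (x $$ (pos i, pos j) \<cdot>\<^sub>m y)" "q < dim_col (x $$ (pos i, pos j) \<cdot>\<^sub>m y)"
  then have p: "p < 3 ^ m" and q: "q < 3 ^ m" using y by auto
  show "first_slice m i j (x \<otimes>\<^sub>K y) $$ (p, q) = (x $$ (pos i, pos j) \<cdot>\<^sub>m y) $$ (p, q)"
    using x y p q block_less[OF pos_less p, of i] block_less[OF pos_less q, of j]
    by (simp add: first_slice_def kron_index)
qed (use y in auto)

lemma first_slice_kron':
  assumes x: "x \<in> M3_tensor (Suc a)" and y: "y \<in> M3_tensor b"
  shows "first_slice (a + b) i j (x \<otimes>\<^sub>K y) = first_slice a i j x \<otimes>\<^sub>K y"
proof (rule eq_matI)
  fix p q assume "p < dim_row (first_slice a i j x \<otimes>\<^sub>K y)" "q < dim_col (first_slice a i j x \<otimes>\<^sub>K y)"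
  then have p: "p < 3 ^ a * 3 ^ b" and q: "q < 3 ^ a * 3 ^ b" using y by auto
  have *: "(pos k * (3 ^ a * 3 ^ b) + t) div 3 ^ b = pos k * 3 ^ a + t div 3 ^ b"
       "(pos k * (3 ^ a * 3 ^ b) + t) mod 3 ^ b = t mod 3 ^ b" for k t :: nat
  proof -
    have eq: "pos k * (3 ^ a * 3 ^ b) + t = t + 3 ^ b * (pos k * 3 ^ a)" by (simp add: mult_ac)
    show "(pos k * (3 ^ a * 3 ^ b) + t) div 3 ^ b = pos k * 3 ^ a + t div 3 ^ b"
      "(pos k * (3 ^ a * 3 ^ b) + t) mod 3 ^ b = t mod 3 ^ b" unfolding eq by simp_all
  qed
  show "first_slice (a + b) i j (x \<otimes>\<^sub>K y) $$ (p, q) = (first_slice a i j x \<otimes>\<^sub>K y) $$ (p, q)"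
    using x y p q block_less[OF pos_less p, of i] block_less[OF pos_less q, of j]
    by (simp add: first_slice_def kron_index power_add * less_mult_imp_div_less mult.assoc)
qed (use y in \<open>auto simp: power_add\<close>)

lemma first_slice_add:
  assumes "x \<in> M3_tensor (Suc m)" "y \<in> M3_tensor (Suc m)"
  shows "first_slice m i j (x + y) = first_slice m i j x + first_slice m i j y"
  using assms block_less[OF pos_less, of _ "3 ^ m"]
  by (auto intro!: eq_matI simp: first_slice_def)

lemma first_slice_smult:
  assumes "x \<in> M3_tensor (Suc m)"
  shows "first_slice m i j (c \<cdot>\<^sub>m x) = c \<cdot>\<^sub>m first_slice m i j x"
  using assms block_less[OF pos_less, of _ "3 ^ m"]
  by (auto intro!: eq_matI simp: first_slice_def)

lemma first_slice_zero: "first_slice m i j (0\<^sub>m (3 ^ Suc m) (3 ^ Suc m)) = 0\<^sub>m (3 ^ m) (3 ^ m)"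
  using block_less[OF pos_less, of _ "3 ^ m"]
  by (auto intro!: eq_matI simp: first_slice_def)

lemma kron_add_left:
  assumes "x \<in> carrier_mat r c" "x' \<in> carrier_mat r c"
  shows "(x + x') \<otimes>\<^sub>K y = x \<otimes>\<^sub>K y + x' \<otimes>\<^sub>K y"
  using assms
  by (auto intro!: eq_matI simp: kron_index less_mult_imp_div_less algebra_simps)

lemma kron_smult_left: "(a \<cdot>\<^sub>m x) \<otimes>\<^sub>K y = a \<cdot>\<^sub>m (x \<otimes>\<^sub>K y)"
  by (auto intro!: eq_matI simp: kron_index less_mult_imp_div_less)

lemma kron_scalar:
  assumes "x \<in> carrier_mat 1 1" shows "x \<otimes>\<^sub>K y = x $$ (0, 0) \<cdot>\<^sub>m y"
  using assms by (auto intro!: eq_matI simp: kron_index)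

lemma alpha_carrier: "alpha n j \<in> M3_tensor (n + 1)"
  using kron_carrier[OF munit_carrier(1) tensor_power_carrier[OF munit_carrier(1)]]
  by (simp add: alpha_def)

lemma beta_head_carrier: "munit j j \<otimes>\<^sub>K munit 1 1 + munit (j + 2) (j + 2) \<otimes>\<^sub>K munit 3 3 \<in> M3_tensor (Suc (Suc 0))"
  by (rule carrier_matI) simp_all

lemma beta_carrier:
  assumes "1 \<le> k" shows "beta k j \<in> M3_tensor (k + 1)"
proof -
  have "(3::nat) ^ Suc (Suc 0) * 3 ^ (k - 1) = 3 ^ (k + 1)"
    using assms by (cases k) auto
  then show ?thesis
    using kron_carrier[OF beta_head_carrier tensor_power_carrier[OF munit_carrier(1)]]
    unfolding beta_def by metis
qed

lemma A_gens_carrier: "A_gens n \<subseteq> M3_tensor (n + 1)"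
proof
  fix b assume "b \<in> A_gens n"
  then consider j where "b = alpha n j"
    | x j k where "b = x \<otimes>\<^sub>K beta k j" "1 \<le> k" "k \<le> n" "x \<in> M3_tensor (n - k)"
    unfolding A_gens_def by auto
  then show "b \<in> M3_tensor (n + 1)"
  proof cases
    case 1 then show ?thesis using alpha_carrier by simp
  next
    case 2
    have "(3::nat) ^ (n - k) * 3 ^ (k + 1) = 3 ^ (n + 1)"
      using 2 by (simp flip: power_add)
    then show ?thesis using kron_carrier[OF 2(4) beta_carrier[OF 2(2)]] 2(1) by metis
  qed
qed

lemma module_mat_module:
  "Module.module (class_ring :: complex ring) (module_mat TYPE(complex) nr nc)"
  using matrix_vs[where 'a = complex] by (simp add: vectorspace_def)

lemma A_alg_carrier: "A_alg n \<subseteq> M3_tensor (n + 1)"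
  using LinearCombinations.module.span_is_subset2[OF module_mat_module] A_gens_carrier
  unfolding A_alg_def by (metis module_mat_simps(5))

lemma A_gens_subset: "A_gens n \<subseteq> A_alg n"
  using LinearCombinations.module.in_own_span[OF module_mat_module] A_gens_carrier
  unfolding A_alg_def by (metis module_mat_simps(5))

lemma A_alg_submodule:
  "LinearCombinations.submodule class_ring (A_alg n) (module_mat TYPE(complex) (3 ^ (n + 1)) (3 ^ (n + 1)))"
  using LinearCombinations.module.span_is_submodule[OF module_mat_module] A_gens_carrier
  unfolding A_alg_def by (metis module_mat_simps(5))

lemma A_alg_closed:
  shows "0\<^sub>m (3 ^ (n + 1)) (3 ^ (n + 1)) \<in> A_alg n"
    and "x \<in> A_alg n \<Longrightarrow> y \<in> A_alg n \<Longrightarrow> x + y \<in> A_alg n"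
    and "x \<in> A_alg n \<Longrightarrow> c \<cdot>\<^sub>m x \<in> A_alg n"
  using submodule.zero_closed[OF A_alg_submodule[of n]] submodule.m_closed[OF A_alg_submodule[of n]]
    submodule.smult_closed[OF A_alg_submodule[of n], of c]
  by (simp_all add: module_mat_simps)

lemma A_alg_induct [consumes 1, case_names gen zero add smult]:
  assumes b: "b \<in> A_alg n"
    and gen: "\<And>x. x \<in> A_gens n \<Longrightarrow> P x"
    and zero: "P (0\<^sub>m (3 ^ (n + 1)) (3 ^ (n + 1)))"
    and add: "\<And>x y. x \<in> M3_tensor (n + 1) \<Longrightarrow> y \<in> M3_tensor (n + 1) \<Longrightarrow> P x \<Longrightarrow> P y \<Longrightarrow> P (x + y)"
    and smult: "\<And>c x. x \<in> M3_tensor (n + 1) \<Longrightarrow> P x \<Longrightarrow> P (c \<cdot>\<^sub>m x)"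
  shows "P b"
proof -
  have "submodule class_ring {x \<in> M3_tensor (n + 1). P x}
      (module_mat TYPE(complex) (3 ^ (n + 1)) (3 ^ (n + 1)))"
    using module_mat_module zero add smult
    by (auto simp: submodule_def module_mat_simps)
  then have "A_alg n \<subseteq> {x \<in> M3_tensor (n + 1). P x}"
    unfolding A_alg_def
    using A_gens_carrier gen
    by (intro LinearCombinations.module.span_is_subset[OF module_mat_module]) auto
  then show ?thesis using b by auto
qed

lemma first_slice_gens:
  assumes "b \<in> A_gens (n + 1)"
  shows "first_slice (n + 1) i j b \<in> A_alg n"
proof -
  have alpha_in: "alpha n l \<in> A_alg n" if "l \<in> {1..3}" for l
    using that A_gens_subset unfolding A_gens_def by blast
  from assms consider l where "b = alpha (n + 1) l"
    | x l k where "b = x \<otimes>\<^sub>K beta k l" "1 \<le> k" "k \<le> n + 1" "l \<in> {1..3}" "x \<in> M3_tensor (n + 1 - k)"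
    unfolding A_gens_def by (auto simp del: carrier_matD)
  then consider l where "b = alpha (n + 1) l"
    | x l k where "b = x \<otimes>\<^sub>K beta k l" "1 \<le> k" "k \<le> n" "l \<in> {1..3}" "x \<in> M3_tensor (n + 1 - k)"
    | x l where "b = x \<otimes>\<^sub>K beta (n + 1) l" "x \<in> carrier_mat 1 1"
  proof cases
    case (2 x l k)
    show thesis
    proof (cases "k = n + 1")
      case True then show thesis using that(3)[of x l] 2 by simp
    next
      case False then show thesis using that(2)[of x k l] 2 by simp
    qed
  qed (use that(1) in blast)
  then show ?thesis
  proof cases
    case 1
    have "tensor_power (munit 2 2) (n + 1) = alpha n 2" by (simp add: alpha_def)
    then have "b = munit l l \<otimes>\<^sub>K alpha n 2" using 1 by (simp add: alpha_def)
    then have "first_slice (n + 1) i j b = munit l l $$ (pos i, pos j) \<cdot>\<^sub>m alpha n 2"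
      using first_slice_kron[OF munit_carrier(1) alpha_carrier] by metis
    then show ?thesis using A_alg_closed(3)[OF alpha_in[of 2]] by simp
  next
    case 2
    have "n - k + (k + 1) = n + 1" "n + 1 - k = Suc (n - k)" using 2 by auto
    then have "first_slice (n + 1) i j b = first_slice (n - k) i j x \<otimes>\<^sub>K beta k l"
      using first_slice_kron'[of x "n - k" "beta k l" "k + 1" i j] 2 beta_carrier[of k l] by simp
    moreover have "first_slice (n - k) i j x \<otimes>\<^sub>K beta k l \<in> A_gens n"
      unfolding A_gens_def using 2(2-4) first_slice_carrier(1)[of "n - k" i j x]
      by (intro UnI2 CollectI exI[of _ "first_slice (n - k) i j x"] exI[of _ l] exI[of _ k]) simp
    ultimately show ?thesis using A_gens_subset by auto
  next
    case 3
    let ?h = "munit l l \<otimes>\<^sub>K munit 1 1 + munit (l + 2) (l + 2) \<otimes>\<^sub>K munit 3 3"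
    let ?t = "tensor_power (munit 2 2) n"
    let ?c = "munit l l $$ (pos i, pos j)" and ?d = "munit (l + 2) (l + 2) $$ (pos i, pos j)"
    have t: "?t \<in> M3_tensor n" by (rule tensor_power_carrier) simp
    have h: "first_slice (Suc 0) i j ?h = ?c \<cdot>\<^sub>m munit 1 1 + ?d \<cdot>\<^sub>m munit 3 3"
    proof -
      have one: "munit k k \<in> M3_tensor (Suc 0)" for k by (rule carrier_matI) simp_all
      have two: "munit k k \<otimes>\<^sub>K munit k' k' \<in> M3_tensor (Suc (Suc 0))" for k k'
        by (rule carrier_matI) simp_all
      show ?thesis
        unfolding first_slice_add[OF two two] first_slice_kron[OF munit_carrier(1) one] ..
    qed
    have "first_slice (n + 1) i j (beta (n + 1) l) = first_slice (Suc 0) i j ?h \<otimes>\<^sub>K ?t"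
      using first_slice_kron'[OF beta_head_carrier t, of i j] by (simp add: beta_def)
    also have "\<dots> = ?c \<cdot>\<^sub>m alpha n 1 + ?d \<cdot>\<^sub>m alpha n 3"
      unfolding h alpha_def
      by (simp add: kron_smult_left kron_add_left[of _ 3 3])
    finally have s: "first_slice (n + 1) i j (beta (n + 1) l) \<in> A_alg n"
      using A_alg_closed alpha_in by simp
    have "first_slice (n + 1) i j b = x $$ (0, 0) \<cdot>\<^sub>m first_slice (n + 1) i j (beta (n + 1) l)"
      unfolding 3(1) kron_scalar[OF 3(2)]
      using beta_carrier[of "n + 1" l] by (intro first_slice_smult) auto
    then show ?thesis using s A_alg_closed by simp
  qed
qed

lemma first_slice_A_alg:
  assumes "b \<in> A_alg (n + 1)"
  shows "first_slice (n + 1) i j b \<in> A_alg n"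
  using assms
proof (induction rule: A_alg_induct)
  case (gen x) then show ?case by (rule first_slice_gens)
next
  case zero then show ?case using first_slice_zero[of "n + 1" i j] A_alg_closed(1)[of n] by simp
next
  case (add x y) then show ?case using first_slice_add[of x "n + 1" y i j] A_alg_closed by simp
next
  case (smult c x) then show ?case using first_slice_smult[of x "n + 1" i j c] A_alg_closed by simp
qed

lemma vertex_value_unique:
  assumes c: "\<And>i. c i \<in> M3_tensor n" and i: "i \<in> {1..3}"
  shows "vertex_value n (c 1 \<otimes>\<^sub>K munit 1 1 + c 2 \<otimes>\<^sub>K munit 2 2 + c 3 \<otimes>\<^sub>K munit 3 3) i = c i"
proof -
  have dims: "dim_row (c k) = 3 ^ n" "dim_col (c k) = 3 ^ n" for k using c[of k] by auto
  have less: "3 * p + pos i < 3 ^ n * 3" if "p < 3 ^ n" for p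
    using block_less[OF that pos_less[of i]] by (simp add: mult.commute)
  have i': "i = 1 \<or> i = 2 \<or> i = 3" using i by auto
  show ?thesis
    by (rule eq_matI; use less i' in \<open>auto simp: vertex_value_def kron_index dims munit_def pos_def\<close>)
qed

definition last_diag :: "complex mat \<Rightarrow> bool" where
  "last_diag b \<longleftrightarrow> 3 dvd dim_row b \<and> 3 dvd dim_col b \<and>
     (\<forall>p < dim_row b. \<forall>q < dim_col b. p mod 3 \<noteq> q mod 3 \<longrightarrow> b $$ (p, q) = 0)"

lemma last_diag_kron:
  assumes "last_diag y" shows "last_diag (x \<otimes>\<^sub>K y)"
proof -
  have "(x \<otimes>\<^sub>K y) $$ (p, q) = 0"
    if "p < dim_row x * dim_row y" "q < dim_col x * dim_col y" "p mod 3 \<noteq> q mod 3" for p q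
  proof -
    have "0 < dim_row y" "0 < dim_col y" using that by (auto intro: Nat.gr0I)
    moreover have "p mod dim_row y mod 3 = p mod 3" "q mod dim_col y mod 3 = q mod 3"
      using assms by (simp_all add: last_diag_def mod_mod_cancel)
    ultimately have "y $$ (p mod dim_row y, q mod dim_col y) = 0"
      using assms that(3) unfolding last_diag_def by simp
    then show ?thesis using that by (simp add: kron_index)
  qed
  then show ?thesis using assms by (auto simp: last_diag_def)
qed

lemma last_diag_munit: "last_diag (munit j j)"
  by (auto simp: last_diag_def munit_def)

lemma kron_one: "x \<otimes>\<^sub>K 1\<^sub>m 1 = x"
  by (rule eq_matI) (auto simp: kron_index)

lemma last_diag_tensor_power:
  assumes "last_diag y" shows "last_diag (y \<otimes>\<^sub>K tensor_power (munit j j) n)"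
proof (cases n)
  case 0 then show ?thesis using assms by (simp add: kron_one[simplified])
next
  case (Suc m)
  have "last_diag (tensor_power (munit j j) (Suc m))"
    by (induction m) (auto simp: kron_one[simplified] last_diag_munit intro: last_diag_kron)
  then show ?thesis unfolding Suc by (rule last_diag_kron)
qed

lemma last_diag_gens:
  assumes "b \<in> A_gens n" shows "last_diag b"
proof -
  have "last_diag (munit j j \<otimes>\<^sub>K munit 1 1 + munit (j + 2) (j + 2) \<otimes>\<^sub>K munit 3 3)" for j
    using last_diag_kron[OF last_diag_munit, of "munit j j" 1]
      last_diag_kron[OF last_diag_munit, of "munit (j + 2) (j + 2)" 3]
    by (simp add: last_diag_def)
  then have "last_diag (alpha n j)" "last_diag (beta k j)" for j k
    unfolding alpha_def beta_def by (intro last_diag_tensor_power last_diag_munit; blast)+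
  then show ?thesis
    using assms last_diag_kron unfolding A_gens_def by blast
qed

lemma A_alg_decomp:
  assumes "b \<in> A_alg n"
  shows "b = vertex_value n b 1 \<otimes>\<^sub>K munit 1 1 + vertex_value n b 2 \<otimes>\<^sub>K munit 2 2 +
    vertex_value n b 3 \<otimes>\<^sub>K munit 3 3" (is "b = ?rhs")
proof -
  have diag: "last_diag b" using assms
    by (induction rule: A_alg_induct) (auto simp: last_diag_def dest!: last_diag_gens)
  have b: "b \<in> M3_tensor (n + 1)" using assms A_alg_carrier by auto
  show ?thesis
  proof (rule eq_matI)
    fix p q assume "p < dim_row ?rhs" "q < dim_col ?rhs"
    then have pq: "p < 3 ^ n * 3" "q < 3 ^ n * 3" by (simp_all add: vertex_value_def)
    have "b $$ (p, q) = 0" if "p mod 3 \<noteq> q mod 3"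
      using diag b pq that by (auto simp: last_diag_def)
    moreover have "3 * (p div 3) + p mod 3 = p" "3 * (q div 3) + q mod 3 = q" by simp_all
    moreover have "p mod 3 = 0 \<or> p mod 3 = 1 \<or> p mod 3 = 2" "q mod 3 = 0 \<or> q mod 3 = 1 \<or> q mod 3 = 2"
      by auto
    ultimately show "b $$ (p, q) = ?rhs $$ (p, q)"
      using pq
      by (elim disjE)
         (simp_all add: vertex_value_def kron_index munit_def pos_def less_mult_imp_div_less)
  qed (use b in \<open>simp_all add: vertex_value_def\<close>)
qed

end

theory Submission
  imports Defs
begin

text \<open>
  The trace \<open>Tr |A|\<^sup>2\<close> is the sum of the squared moduli of all entries of \<open>A\<close>, so it
  splits over the nine blocks \<open>(e\<^sub>i\<^sub>j\<^sup>* \<otimes> id) A\<close>. Evaluation at a vertex acts on the last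
  tensor factor and slicing on the first, so the two commute, and the identity holds separately for
  each pair of vertices.
\<close>

text \<open>The diagonal entry of \<open>mat_adjoint A * A\<close> at \<open>q\<close> is the
  squared norm of column \<open>q\<close>; summing over \<open>q\<close> and exchanging the two sums
  gives all entries of \<open>A\<close>.\<close>

lemma Tr_abs_sq:
  "Tr (abs_sq A) = (\<Sum>p<dim_row A. \<Sum>q<dim_col A. cnj (A $$ (p, q)) * A $$ (p, q))"
proof -
  have "Tr (abs_sq A) = (\<Sum>q<dim_col A. \<Sum>p<dim_row A. cnj (A $$ (p, q)) * A $$ (p, q))"
    unfolding Tr_def abs_sq_def
    by (intro sum.cong)
       (auto simp: mat_adjoint_def mat_of_rows_def scalar_prod_def atLeast0LessThan intro!: sum.cong)
  then show ?thesis by (simp add: sum.swap[of _ "{..<dim_col A}"])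
qed

text \<open>Splits an index into its leading base-3 digit and the rest, the digit being written as
  \<open>pos i\<close> to match \<open>first_slice\<close>.\<close>

lemma sum_blocks:
  "(\<Sum>p<3 ^ Suc m. f p) = (\<Sum>i = 1..3. \<Sum>p<3 ^ m. f (pos i * 3 ^ m + p))"
proof -
  have "(\<Sum>p<3 ^ Suc m. f p) = (\<Sum>r<3. sum f {r * 3 ^ m..<r * 3 ^ m + 3 ^ m})"
    using sum.nat_group[of f "3 ^ m" 3] by (simp add: mult.commute)
  also have "\<dots> = (\<Sum>r<3. \<Sum>p<3 ^ m. f (r * 3 ^ m + p))"
  proof (rule sum.cong)
    fix r :: nat
    show "sum f {r * 3 ^ m..<r * 3 ^ m + 3 ^ m} = (\<Sum>p<3 ^ m. f (r * 3 ^ m + p))"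
      by (rule sum.reindex_bij_witness[of _ "\<lambda>p. r * 3 ^ m + p" "\<lambda>p. p - r * 3 ^ m"]) auto
  qed simp
  also have "\<dots> = (\<Sum>i = 1..3. \<Sum>p<3 ^ m. f (pos i * 3 ^ m + p))"
    \<comment> \<open>\<open>pos\<close> maps 1, 2, 3 to 0, 1, 2, with inverse
      \<open>Suc\<close>.\<close>
    by (rule sum.reindex_bij_witness[of _ pos Suc]) (auto simp: pos_def, presburger)
  finally show ?thesis .
qed

lemma Tr_abs_sq_slices:
  assumes "A \<in> M3_tensor (Suc m)"
  shows "Tr (abs_sq A) = (\<Sum>i = 1..3. \<Sum>j = 1..3. Tr (abs_sq (first_slice m i j A)))"
proof -
  let ?g = "\<lambda>p q. cnj (A $$ (p, q)) * A $$ (p, q)"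
  have "Tr (abs_sq A) = (\<Sum>p<3 ^ Suc m. \<Sum>q<3 ^ Suc m. ?g p q)"
    using assms by (simp only: Tr_abs_sq carrier_matD)
  also have "\<dots> = (\<Sum>i = 1..3. \<Sum>p<3 ^ m. \<Sum>j = 1..3. \<Sum>q<3 ^ m.
      ?g (pos i * 3 ^ m + p) (pos j * 3 ^ m + q))"
    unfolding sum_blocks ..
  also have "\<dots> = (\<Sum>i = 1..3. \<Sum>j = 1..3. \<Sum>p<3 ^ m. \<Sum>q<3 ^ m.
      ?g (pos i * 3 ^ m + p) (pos j * 3 ^ m + q))"
    \<comment> \<open>Exchanging the two middle sums gathers the entries of one block
      \<open>(i, j)\<close>, which are those of \<open>first_slice m i j A\<close>.\<close>
    by (intro sum.cong refl sum.swap)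
  also have "\<dots> = (\<Sum>i = 1..3. \<Sum>j = 1..3. Tr (abs_sq (first_slice m i j A)))"
    unfolding Tr_abs_sq by (intro sum.cong) (auto simp: first_slice_def)
  finally show ?thesis .
qed

lemma vertex_value_carrier: "vertex_value n b i \<in> M3_tensor n"
  by (simp add: vertex_value_def)

lemma first_slice_minus:
  assumes "x \<in> M3_tensor (Suc m)" "y \<in> M3_tensor (Suc m)"
  shows "first_slice m i j (x - y) = first_slice m i j x - first_slice m i j y"
  using assms block_less[OF pos_less, of _ "3 ^ m"]
  by (auto intro!: eq_matI simp: first_slice_def)

text \<open>Slicing fixes the first base-3 digit of the row and column indices, evaluation the last.
  Both sides read \<open>b\<close> at row \<open>pos i * 3 ^ Suc m + 3 * p + pos k\<close> and the
  analogous column.\<close>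

lemma vertex_value_first_slice:
  "vertex_value m (first_slice (Suc m) i j b) k = first_slice m i j (vertex_value (Suc m) b k)"
proof (rule eq_matI)
  fix p q
  assume "p < dim_row (first_slice m i j (vertex_value (Suc m) b k))"
    "q < dim_col (first_slice m i j (vertex_value (Suc m) b k))"
  then have p: "p < 3 ^ m" and q: "q < 3 ^ m" by simp_all
  \<comment> \<open>With the last digit appended, the index still lies inside the slice of size
    \<open>3 ^ Suc m\<close>.\<close>
  have "3 * p + pos k < 3 * 3 ^ m" "3 * q + pos k < 3 * 3 ^ m"
    using p q pos_less[of k] by simp_all
  then show "vertex_value m (first_slice (Suc m) i j b) k $$ (p, q) =
      first_slice m i j (vertex_value (Suc m) b k) $$ (p, q)"
    using p q block_less[OF pos_less p, of i] block_less[OF pos_less q, of j]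
    by (simp add: vertex_value_def first_slice_def algebra_simps)
qed (simp_all add: vertex_value_def)

theorem proposition4p2:
  fixes n :: nat and b :: "complex mat"
  assumes "b \<in> A_alg (n + 1)"
  shows "energy (n + 1) b = (\<Sum>i = 1..3. \<Sum>j = 1..3. energy n (first_slice (n + 1) i j b))"
proof -
  let ?P = "{(k, l). k \<in> {1..3} \<and> l \<in> {1..3} \<and> k \<noteq> (l::nat)}"
  let ?d = "\<lambda>m b (k, l). Tr (abs_sq (vertex_value m b k - vertex_value m b l))"
  \<comment> \<open>For a fixed pair of vertices, the difference of the two values is cut into its
    nine blocks.\<close>
  have "?d (Suc n) b x = (\<Sum>i = 1..3. \<Sum>j = 1..3. ?d n (first_slice (Suc n) i j b) x)" for x
    by (cases x)
       (simp add: Tr_abs_sq_slices[OF minus_carrier_mat[OF vertex_value_carrier]]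
          first_slice_minus[OF vertex_value_carrier vertex_value_carrier] vertex_value_first_slice)
  then have "energy (Suc n) b =
      (\<Sum>x\<in>?P. \<Sum>i = 1..3. \<Sum>j = 1..3. ?d n (first_slice (Suc n) i j b) x)"
    unfolding energy_def by (intro sum.cong refl)
  also have "\<dots> = (\<Sum>i = 1..3. \<Sum>j = 1..3. energy n (first_slice (Suc n) i j b))"
    \<comment> \<open>Fixing the outer set as \<open>?P\<close> lets the sum over pairs move only
      inwards, so the rewriting terminates.\<close>
    unfolding energy_def by (simp only: sum.swap[of _ _ ?P])
  finally show ?thesis by simp
qed

end
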